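(* Let $K$ be a field, let $(A,\prec,\succ,\alpha_A,\beta_A)$ be a BiHom-dendriform algebra with $\alpha_A,\beta_A$ invertible, and let $(M,\prec,\succ,\alpha_M,\beta_M)$ be a BiHom-dendriform bimodule over it with $\alpha_M,\beta_M$ invertible. For $a,b\in A$, $m\in M$ set $$a\circ_\ell m=a\succ m-\alpha_M^{-1}\beta_M(m)\prec\alpha_A\beta_A^{-1}(a),\qquad m\circ_r a=m\succ a-\alpha_A^{-1}\beta_A(a)\prec\alpha_M\beta_M^{-1}(m),$$ $$a\circ b=a\succ b-\alpha_A^{-1}\beta_A(b)\prec\alpha_A\beta_A^{-1}(a).$$ Then $(M,\circ_\ell,\circ_r,\alpha_M,\beta_M)$ is a BiHom-pre-Lie bimodule over the BiHom-pre-Lie algebra $(A,\circ,\alpha_A,\beta_A)$.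
   Context: Everything is over the field $K$. BiHom-dendriform algebra $(A,\prec,\succ,\alpha,\beta)$: bilinear $\prec,\succ$ and linear commuting $\alpha,\beta$, both multiplicative for $\prec$ and $\succ$, with (D1) $(a\prec b)\prec\beta(c)=\alpha(a)\prec(b\prec c)+\alpha(a)\prec(b\succ c)$, (D2) $\alpha(a)\succ(b\prec c)=(a\succ b)\prec\beta(c)$, (D3) $\alpha(a)\succ(b\succ c)=(a\prec b)\succ\beta(c)+(a\succ b)\succ\beta(c)$. BiHom-dendriform bimodule $(M,\prec,\succ,\alpha_M,\beta_M)$ over it: a vector space $M$ with four bilinear operations $a\succ m,\ a\prec m,\ m\succ a,\ m\prec a\in M$ and commuting linear $\alpha_M,\beta_M$ such that $f_M(a\ast m)=f_A(a)\ast f_M(m)$, $f_M(m\ast a)=f_M(m)\ast f_A(a)$ for $f\in\{\alpha,\beta\}$, $\ast\in\{\prec,\succ\}$, and (D1), (D2), (D3) hold whenever exactly one of the three arguments lies in $M$ and the other two in $A$ (with $\alpha,\beta$ read as $\alpha_M,\beta_M$ on the argument in $M$ and as $\alpha_A,\beta_A$ otherwise). (Left) BiHom-pre-Lie algebra $(A,\circ,\alpha,\beta)$: bilinear $\circ$, commuting linear multiplicative $\alpha,\beta$, with $\alpha\beta(a)\circ(\alpha(b)\circ c)-(\beta(a)\circ\alpha(b))\circ\beta(c)=\alpha\beta(b)\circ(\alpha(a)\circ c)-(\beta(b)\circ\alpha(a))\circ\beta(c)$. BiHom-pre-Lie bimodule $(M,\circ_\ell,\circ_r,\alpha_M,\beta_M)$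 over it: bilinear $\circ_\ell:A\otimes M\to M$, $\circ_r:M\otimes A\to M$, commuting linear $\alpha_M,\beta_M$ with $f_M(a\circ_\ell m)=f_A(a)\circ_\ell f_M(m)$, $f_M(m\circ_r a)=f_M(m)\circ_r f_A(a)$ for $f\in\{\alpha,\beta\}$, and $\alpha_A\beta_A(a)\circ_\ell(\alpha_A(b)\circ_\ell m)-(\beta_A(a)\circ\alpha_A(b))\circ_\ell\beta_M(m)=\alpha_A\beta_A(b)\circ_\ell(\alpha_A(a)\circ_\ell m)-(\beta_A(b)\circ\alpha_A(a))\circ_\ell\beta_M(m)$, $\alpha_A\beta_A(a)\circ_\ell(\alpha_M(m)\circ_r c)-(\beta_A(a)\circ_\ell\alpha_M(m))\circ_r\beta_A(c)=\alpha_M\beta_M(m)\circ_r(\alpha_A(a)\circ c)-(\beta_M(m)\circ_r\alpha_A(a))\circ_r\beta_A(c)$. *)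

theory Defs
  imports Complex_Main
begin

text \<open>
  A vector space over the field \<open>K\<close> is a type together with a scalar multiplication satisfying
  the library locale \<^locale>\<open>vector_space\<close>.  In the bimodule locales, subscript \<open>l\<close> marks the operations
  with the algebra element on the left, subscript \<open>r\<close> those with the algebra element on the right.
\<close>

definition bilinear_map ::
  "('k::field \<Rightarrow> 'a::ab_group_add \<Rightarrow> 'a) \<Rightarrow> ('k \<Rightarrow> 'b::ab_group_add \<Rightarrow> 'b) \<Rightarrow>
   ('k \<Rightarrow> 'c::ab_group_add \<Rightarrow> 'c) \<Rightarrow> ('a \<Rightarrow> 'b \<Rightarrow> 'c) \<Rightarrow> bool"
  where "bilinear_map sA sB sC f \<longleftrightarrow>
    (\<forall>x. Vector_Spaces.linear sB sC (f x)) \<and> (\<forall>y. Vector_Spaces.linear sA sC (\<lambda>x. f x y))"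

locale bihom_dendriform_algebra = vector_space sA
  for sA :: "'k::field \<Rightarrow> 'a::ab_group_add \<Rightarrow> 'a" +
  fixes precA :: "'a \<Rightarrow> 'a \<Rightarrow> 'a"  (infixl "\<prec>" 70)
    and succA :: "'a \<Rightarrow> 'a \<Rightarrow> 'a"  (infixl "\<succ>" 70)
    and \<alpha> :: "'a \<Rightarrow> 'a"
    and \<beta> :: "'a \<Rightarrow> 'a"
  assumes bilinear_prec: "bilinear_map sA sA sA (\<prec>)"
    and bilinear_succ: "bilinear_map sA sA sA (\<succ>)"
    and linear_alpha: "Vector_Spaces.linear sA sA \<alpha>"
    and linear_beta: "Vector_Spaces.linear sA sA \<beta>"
    and alpha_beta_commute: "\<alpha> (\<beta> a) = \<beta> (\<alpha> a)"
    and alpha_prec: "\<alpha> (a \<prec> b) = \<alpha> a \<prec> \<alpha> b"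
    and alpha_succ: "\<alpha> (a \<succ> b) = \<alpha> a \<succ> \<alpha> b"
    and beta_prec: "\<beta> (a \<prec> b) = \<beta> a \<prec> \<beta> b"
    and beta_succ: "\<beta> (a \<succ> b) = \<beta> a \<succ> \<beta> b"
    and D1: "(a \<prec> b) \<prec> \<beta> c = \<alpha> a \<prec> (b \<prec> c) + \<alpha> a \<prec> (b \<succ> c)"
    and D2: "\<alpha> a \<succ> (b \<prec> c) = (a \<succ> b) \<prec> \<beta> c"
    and D3: "\<alpha> a \<succ> (b \<succ> c) = (a \<prec> b) \<succ> \<beta> c + (a \<succ> b) \<succ> \<beta> c"

locale bihom_dendriform_bimodule =
  bihom_dendriform_algebra sA precA succA \<alpha> \<beta> + M: vector_space sM
  for sA :: "'k::field \<Rightarrow> 'a::ab_group_add \<Rightarrow> 'a"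
    and precA :: "'a \<Rightarrow> 'a \<Rightarrow> 'a"  (infixl "\<prec>" 70)
    and succA :: "'a \<Rightarrow> 'a \<Rightarrow> 'a"  (infixl "\<succ>" 70)
    and \<alpha> :: "'a \<Rightarrow> 'a"
    and \<beta> :: "'a \<Rightarrow> 'a"
    and sM :: "'k \<Rightarrow> 'm::ab_group_add \<Rightarrow> 'm" +
  fixes lprec :: "'a \<Rightarrow> 'm \<Rightarrow> 'm"  (infixl "\<prec>\<^sub>l" 70)
    and lsucc :: "'a \<Rightarrow> 'm \<Rightarrow> 'm"  (infixl "\<succ>\<^sub>l" 70)
    and rprec :: "'m \<Rightarrow> 'a \<Rightarrow> 'm"  (infixl "\<prec>\<^sub>r" 70)
    and rsucc :: "'m \<Rightarrow> 'a \<Rightarrow> 'm"  (infixl "\<succ>\<^sub>r" 70)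
    and \<alpha>\<^sub>M :: "'m \<Rightarrow> 'm"
    and \<beta>\<^sub>M :: "'m \<Rightarrow> 'm"
  assumes bilinear_lprec: "bilinear_map sA sM sM (\<prec>\<^sub>l)"
    and bilinear_lsucc: "bilinear_map sA sM sM (\<succ>\<^sub>l)"
    and bilinear_rprec: "bilinear_map sM sA sM (\<prec>\<^sub>r)"
    and bilinear_rsucc: "bilinear_map sM sA sM (\<succ>\<^sub>r)"
    and linear_alphaM: "Vector_Spaces.linear sM sM \<alpha>\<^sub>M"
    and linear_betaM: "Vector_Spaces.linear sM sM \<beta>\<^sub>M"
    and alphaM_betaM_commute: "\<alpha>\<^sub>M (\<beta>\<^sub>M m) = \<beta>\<^sub>M (\<alpha>\<^sub>M m)"
    and alphaM_lprec: "\<alpha>\<^sub>M (a \<prec>\<^sub>l m) = \<alpha> a \<prec>\<^sub>l \<alpha>\<^sub>M m"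
    and alphaM_lsucc: "\<alpha>\<^sub>M (a \<succ>\<^sub>l m) = \<alpha> a \<succ>\<^sub>l \<alpha>\<^sub>M m"
    and alphaM_rprec: "\<alpha>\<^sub>M (m \<prec>\<^sub>r a) = \<alpha>\<^sub>M m \<prec>\<^sub>r \<alpha> a"
    and alphaM_rsucc: "\<alpha>\<^sub>M (m \<succ>\<^sub>r a) = \<alpha>\<^sub>M m \<succ>\<^sub>r \<alpha> a"
    and betaM_lprec: "\<beta>\<^sub>M (a \<prec>\<^sub>l m) = \<beta> a \<prec>\<^sub>l \<beta>\<^sub>M m"
    and betaM_lsucc: "\<beta>\<^sub>M (a \<succ>\<^sub>l m) = \<beta> a \<succ>\<^sub>l \<beta>\<^sub>M m"
    and betaM_rprec: "\<beta>\<^sub>M (m \<prec>\<^sub>r a) = \<beta>\<^sub>M m \<prec>\<^sub>r \<beta> a"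
    and betaM_rsucc: "\<beta>\<^sub>M (m \<succ>\<^sub>r a) = \<beta>\<^sub>M m \<succ>\<^sub>r \<beta> a"
    and D1_first: "(m \<prec>\<^sub>r b) \<prec>\<^sub>r \<beta> c = \<alpha>\<^sub>M m \<prec>\<^sub>r (b \<prec> c) + \<alpha>\<^sub>M m \<prec>\<^sub>r (b \<succ> c)"
    and D1_second: "(a \<prec>\<^sub>l m) \<prec>\<^sub>r \<beta> c = \<alpha> a \<prec>\<^sub>l (m \<prec>\<^sub>r c) + \<alpha> a \<prec>\<^sub>l (m \<succ>\<^sub>r c)"
    and D1_third: "(a \<prec> b) \<prec>\<^sub>l \<beta>\<^sub>M m = \<alpha> a \<prec>\<^sub>l (b \<prec>\<^sub>l m) + \<alpha> a \<prec>\<^sub>l (b \<succ>\<^sub>l m)"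
    and D2_first: "\<alpha>\<^sub>M m \<succ>\<^sub>r (b \<prec> c) = (m \<succ>\<^sub>r b) \<prec>\<^sub>r \<beta> c"
    and D2_second: "\<alpha> a \<succ>\<^sub>l (m \<prec>\<^sub>r c) = (a \<succ>\<^sub>l m) \<prec>\<^sub>r \<beta> c"
    and D2_third: "\<alpha> a \<succ>\<^sub>l (b \<prec>\<^sub>l m) = (a \<succ> b) \<prec>\<^sub>l \<beta>\<^sub>M m"
    and D3_first: "\<alpha>\<^sub>M m \<succ>\<^sub>r (b \<succ> c) = (m \<prec>\<^sub>r b) \<succ>\<^sub>r \<beta> c + (m \<succ>\<^sub>r b) \<succ>\<^sub>r \<beta> c"
    and D3_second: "\<alpha> a \<succ>\<^sub>l (m \<succ>\<^sub>r c) = (a \<prec>\<^sub>l m) \<succ>\<^sub>r \<beta> c + (a \<succ>\<^sub>l m) \<succ>\<^sub>r \<beta> c"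
    and D3_third: "\<alpha> a \<succ>\<^sub>l (b \<succ>\<^sub>l m) = (a \<prec> b) \<succ>\<^sub>l \<beta>\<^sub>M m + (a \<succ> b) \<succ>\<^sub>l \<beta>\<^sub>M m"

locale bihom_prelie_algebra = vector_space sA
  for sA :: "'k::field \<Rightarrow> 'a::ab_group_add \<Rightarrow> 'a" +
  fixes circA :: "'a \<Rightarrow> 'a \<Rightarrow> 'a"  (infixl "\<odot>" 70)
    and \<alpha> :: "'a \<Rightarrow> 'a"
    and \<beta> :: "'a \<Rightarrow> 'a"
  assumes bilinear_circ: "bilinear_map sA sA sA (\<odot>)"
    and linear_alpha: "Vector_Spaces.linear sA sA \<alpha>"
    and linear_beta: "Vector_Spaces.linear sA sA \<beta>"
    and alpha_beta_commute: "\<alpha> (\<beta> a) = \<beta> (\<alpha> a)"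
    and alpha_circ: "\<alpha> (a \<odot> b) = \<alpha> a \<odot> \<alpha> b"
    and beta_circ: "\<beta> (a \<odot> b) = \<beta> a \<odot> \<beta> b"
    and prelie:
      "\<alpha> (\<beta> a) \<odot> (\<alpha> b \<odot> c) - (\<beta> a \<odot> \<alpha> b) \<odot> \<beta> c =
       \<alpha> (\<beta> b) \<odot> (\<alpha> a \<odot> c) - (\<beta> b \<odot> \<alpha> a) \<odot> \<beta> c"

locale bihom_prelie_bimodule =
  bihom_prelie_algebra sA circA \<alpha> \<beta> + M: vector_space sM
  for sA :: "'k::field \<Rightarrow> 'a::ab_group_add \<Rightarrow> 'a"
    and circA :: "'a \<Rightarrow> 'a \<Rightarrow> 'a"  (infixl "\<odot>" 70)
    and \<alpha> :: "'a \<Rightarrow> 'a"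
    and \<beta> :: "'a \<Rightarrow> 'a"
    and sM :: "'k \<Rightarrow> 'm::ab_group_add \<Rightarrow> 'm" +
  fixes lcirc :: "'a \<Rightarrow> 'm \<Rightarrow> 'm"  (infixl "\<odot>\<^sub>l" 70)
    and rcirc :: "'m \<Rightarrow> 'a \<Rightarrow> 'm"  (infixl "\<odot>\<^sub>r" 70)
    and \<alpha>\<^sub>M :: "'m \<Rightarrow> 'm"
    and \<beta>\<^sub>M :: "'m \<Rightarrow> 'm"
  assumes bilinear_lcirc: "bilinear_map sA sM sM (\<odot>\<^sub>l)"
    and bilinear_rcirc: "bilinear_map sM sA sM (\<odot>\<^sub>r)"
    and linear_alphaM: "Vector_Spaces.linear sM sM \<alpha>\<^sub>M"
    and linear_betaM: "Vector_Spaces.linear sM sM \<beta>\<^sub>M"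
    and alphaM_betaM_commute: "\<alpha>\<^sub>M (\<beta>\<^sub>M m) = \<beta>\<^sub>M (\<alpha>\<^sub>M m)"
    and alphaM_lcirc: "\<alpha>\<^sub>M (a \<odot>\<^sub>l m) = \<alpha> a \<odot>\<^sub>l \<alpha>\<^sub>M m"
    and alphaM_rcirc: "\<alpha>\<^sub>M (m \<odot>\<^sub>r a) = \<alpha>\<^sub>M m \<odot>\<^sub>r \<alpha> a"
    and betaM_lcirc: "\<beta>\<^sub>M (a \<odot>\<^sub>l m) = \<beta> a \<odot>\<^sub>l \<beta>\<^sub>M m"
    and betaM_rcirc: "\<beta>\<^sub>M (m \<odot>\<^sub>r a) = \<beta>\<^sub>M m \<odot>\<^sub>r \<beta> a"
    and prelie_left:
      "\<alpha> (\<beta> a) \<odot>\<^sub>l (\<alpha> b \<odot>\<^sub>l m) - (\<beta> a \<odot> \<alpha> b) \<odot>\<^sub>l \<beta>\<^sub>M m =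
       \<alpha> (\<beta> b) \<odot>\<^sub>l (\<alpha> a \<odot>\<^sub>l m) - (\<beta> b \<odot> \<alpha> a) \<odot>\<^sub>l \<beta>\<^sub>M m"
    and prelie_middle:
      "\<alpha> (\<beta> a) \<odot>\<^sub>l (\<alpha>\<^sub>M m \<odot>\<^sub>r c) - (\<beta> a \<odot>\<^sub>l \<alpha>\<^sub>M m) \<odot>\<^sub>r \<beta> c =
       \<alpha>\<^sub>M (\<beta>\<^sub>M m) \<odot>\<^sub>r (\<alpha> a \<odot> c) - (\<beta>\<^sub>M m \<odot>\<^sub>r \<alpha> a) \<odot>\<^sub>r \<beta> c"

end

theory Submission
  imports Defs
begin

text \<open>
  For an element \<open>x\<close> of the bimodule and elements \<open>a, b\<close> of the algebra, expanding the BiHom-associator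
  \<open>\<alpha>\<beta>(a) \<circ> (\<alpha>(b) \<circ> x) - (\<beta>(a) \<circ> \<alpha>(b)) \<circ> \<beta>(x)\<close> and applying each of (D1), (D2), (D3) once cancels all
  terms that are not symmetric in \<open>a, b\<close>.  Placing the bimodule element in the third or in the second
  position gives the two bimodule identities.  The pre-Lie identity of the algebra is the first of
  them for the algebra regarded as a bimodule over itself.
\<close>

lemma linear_map_diff:
  assumes "Vector_Spaces.linear s1 s2 f"
  shows "f (x - y) = f x - f y"
  using assms module_hom.diff unfolding linear_iff_module_hom by blast

lemma bilinear_map_diff_left:
  assumes "bilinear_map sA sB sC f"
  shows "f (x - y) z = f x z - f y z"
  using assms linear_map_diff[of sA sC "\<lambda>x. f x z"] unfolding bilinear_map_def by blast

lemma bilinear_map_diff_right: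
  assumes "bilinear_map sA sB sC f"
  shows "f z (x - y) = f z x - f z y"
  using assms linear_map_diff[of sB sC "f z"] unfolding bilinear_map_def by blast

text \<open>Used first to move \<open>\<beta>\<close> past \<open>inv \<alpha>\<close>, then, with
  \<open>\<beta>\<close> in the role of \<open>f\<close>, to move \<open>\<alpha>\<close> and
  \<open>inv \<alpha>\<close> past \<open>inv \<beta>\<close>; likewise for the maps on the
  module.\<close>

lemma inv_commute:
  assumes "bij f" and "\<And>x. f (g x) = g (f x)"
  shows "g (inv f x) = inv f (g x)"
proof -
  have "f (g (inv f x)) = g x"
    using assms(1) by (simp add: assms(2) bij_is_surj surj_f_inv_f)
  then show ?thesis
    using assms(1) by (metis bij_inv_eq_iff)
qed

lemma linear_inv:
  assumes "Vector_Spaces.linear s s f" and "bij f"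
  shows "Vector_Spaces.linear s s (inv f)"
proof -
  interpret f: Vector_Spaces.linear s s f by fact
  have [simp]: "f (inv f x) = x" for x
    using assms(2) by (simp add: bij_is_surj surj_f_inv_f)
  have eqI: "inv f x = y" if "f y = x" for x y
    using that assms(2) by (simp add: bij_is_inj inv_f_eq)
  show ?thesis
    by unfold_locales (auto intro!: eqI simp: f.add f.scale)
qed

text \<open>The common shape of both module products: \<open>g\<close> takes its arguments in
  swapped order, \<open>k\<close> is the twist "inverse \<alpha> after \<beta>" and \<open>h\<close>
  the twist "\<alpha> after inverse \<beta>".\<close>

lemma bilinear_map_twisted_diff:
  assumes f: "bilinear_map sA sB sC f" and g: "bilinear_map sB sA sC g"
    and h: "Vector_Spaces.linear sA sA h" and k: "Vector_Spaces.linear sB sB k"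
  shows "bilinear_map sA sB sC (\<lambda>x y. f x y - g (k y) (h x))"
proof -
  have "Vector_Spaces.linear sB sC (\<lambda>y. f x y - g (k y) (h x))" for x
  proof -
    interpret f: Vector_Spaces.linear sB sC "f x" using f by (simp add: bilinear_map_def)
    interpret g: Vector_Spaces.linear sB sC "\<lambda>y. g y (h x)" using g by (simp add: bilinear_map_def)
    interpret k: Vector_Spaces.linear sB sB k by fact
    show ?thesis
      by unfold_locales (simp_all add: f.add g.add k.add f.scale g.scale k.scale
          f.vs2.scale_right_diff_distrib)
  qed
  moreover have "Vector_Spaces.linear sA sC (\<lambda>x. f x y - g (k y) (h x))" for y
  proof -
    interpret f: Vector_Spaces.linear sA sC "\<lambda>x. f x y" using f by (simp add: bilinear_map_def)
    interpret g: Vector_Spaces.linear sA sC "g (k y)" using g by (simp add: bilinear_map_def)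
    interpret h: Vector_Spaces.linear sA sA h by fact
    show ?thesis
      by unfold_locales (simp_all add: f.add g.add h.add f.scale g.scale h.scale
          f.vs2.scale_right_diff_distrib)
  qed
  ultimately show ?thesis by (simp add: bilinear_map_def)
qed

text \<open>With \<open>M = A\<close> the three placements of the module element in each of (D1),
  (D2), (D3) all become the axiom itself. This lets the results on bimodules yield the pre-Lie
  structure on the algebra.\<close>

lemma (in bihom_dendriform_algebra) regular_bimodule:
  "bihom_dendriform_bimodule sA (\<prec>) (\<succ>) \<alpha> \<beta> sA (\<prec>) (\<succ>) (\<prec>) (\<succ>) \<alpha> \<beta>"
  by (intro bihom_dendriform_bimodule.intro bihom_dendriform_bimodule_axioms.intro
      bihom_dendriform_algebra_axioms vector_space_axioms bilinear_prec bilinear_succ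
      linear_alpha linear_beta alpha_beta_commute alpha_prec alpha_succ beta_prec beta_succ D1 D2 D3)

locale invertible_bihom_dendriform_bimodule = bihom_dendriform_bimodule +
  assumes bij_alpha: "bij \<alpha>" and bij_beta: "bij \<beta>"
    and bij_alphaM: "bij \<alpha>\<^sub>M" and bij_betaM: "bij \<beta>\<^sub>M"
begin

text \<open>Abbreviations, so that simplification acts directly on the underlying dendriform
  terms.\<close>

abbreviation circ (infixl "\<odot>" 70)
  where "a \<odot> b \<equiv> a \<succ> b - inv \<alpha> (\<beta> b) \<prec> \<alpha> (inv \<beta> a)"

abbreviation lcirc (infixl "\<odot>\<^sub>l" 70)
  where "a \<odot>\<^sub>l m \<equiv> a \<succ>\<^sub>l m - inv \<alpha>\<^sub>M (\<beta>\<^sub>M m) \<prec>\<^sub>r \<alpha> (inv \<beta> a)"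

abbreviation rcirc (infixl "\<odot>\<^sub>r" 70)
  where "m \<odot>\<^sub>r a \<equiv> m \<succ>\<^sub>r a - inv \<alpha> (\<beta> a) \<prec>\<^sub>l \<alpha>\<^sub>M (inv \<beta>\<^sub>M m)"

lemma inv_cancel:
  "\<alpha> (inv \<alpha> a) = a" "inv \<alpha> (\<alpha> a) = a" "\<beta> (inv \<beta> a) = a" "inv \<beta> (\<beta> a) = a"
  "\<alpha>\<^sub>M (inv \<alpha>\<^sub>M m) = m" "inv \<alpha>\<^sub>M (\<alpha>\<^sub>M m) = m" "\<beta>\<^sub>M (inv \<beta>\<^sub>M m) = m" "inv \<beta>\<^sub>M (\<beta>\<^sub>M m) = m"
  using bij_alpha bij_beta bij_alphaM bij_betaM
  by (simp_all add: bij_is_surj surj_f_inv_f bij_is_inj inv_f_f)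

lemma inv_eqI:
  "\<alpha> b = a \<Longrightarrow> inv \<alpha> a = b" "\<beta> b = a \<Longrightarrow> inv \<beta> a = b"
  "\<alpha>\<^sub>M n = m \<Longrightarrow> inv \<alpha>\<^sub>M m = n" "\<beta>\<^sub>M n = m \<Longrightarrow> inv \<beta>\<^sub>M m = n"
  by (auto simp: inv_cancel)

text \<open>Oriented so that words in the structure maps get \<open>\<alpha>\<close> and its inverse on the outside.\<close>

lemma structure_maps_commute:
  "\<beta> (\<alpha> a) = \<alpha> (\<beta> a)" "\<beta> (inv \<alpha> a) = inv \<alpha> (\<beta> a)"
  "inv \<beta> (\<alpha> a) = \<alpha> (inv \<beta> a)" "inv \<beta> (inv \<alpha> a) = inv \<alpha> (inv \<beta> a)"
  "\<beta>\<^sub>M (\<alpha>\<^sub>M m) = \<alpha>\<^sub>M (\<beta>\<^sub>M m)" "\<beta>\<^sub>M (inv \<alpha>\<^sub>M m) = inv \<alpha>\<^sub>M (\<beta>\<^sub>M m)"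
  "inv \<beta>\<^sub>M (\<alpha>\<^sub>M m) = \<alpha>\<^sub>M (inv \<beta>\<^sub>M m)" "inv \<beta>\<^sub>M (inv \<alpha>\<^sub>M m) = inv \<alpha>\<^sub>M (inv \<beta>\<^sub>M m)"
proof -
  have \<beta>_inv: "\<beta> (inv \<alpha> a) = inv \<alpha> (\<beta> a)" for a
    by (rule inv_commute[of \<alpha> \<beta>, OF bij_alpha alpha_beta_commute])
  have \<beta>\<^sub>M_inv: "\<beta>\<^sub>M (inv \<alpha>\<^sub>M m) = inv \<alpha>\<^sub>M (\<beta>\<^sub>M m)" for m
    by (rule inv_commute[of \<alpha>\<^sub>M \<beta>\<^sub>M, OF bij_alphaM alphaM_betaM_commute])
  show "\<beta> (\<alpha> a) = \<alpha> (\<beta> a)" "\<beta> (inv \<alpha> a) = inv \<alpha> (\<beta> a)"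
    "\<beta>\<^sub>M (\<alpha>\<^sub>M m) = \<alpha>\<^sub>M (\<beta>\<^sub>M m)" "\<beta>\<^sub>M (inv \<alpha>\<^sub>M m) = inv \<alpha>\<^sub>M (\<beta>\<^sub>M m)"
    by (simp_all only: alpha_beta_commute alphaM_betaM_commute \<beta>_inv \<beta>\<^sub>M_inv)
  show "inv \<beta> (\<alpha> a) = \<alpha> (inv \<beta> a)" "inv \<beta> (inv \<alpha> a) = inv \<alpha> (inv \<beta> a)"
    \<comment> \<open>Here \<open>\<beta>\<close> is the inverted map; the map commuting with it is
      \<open>\<alpha>\<close> in the first claim and \<open>inv \<alpha>\<close> in the
      second.\<close>
    by (rule inv_commute[symmetric, OF bij_beta], simp only: alpha_beta_commute \<beta>_inv)+
  show "inv \<beta>\<^sub>M (\<alpha>\<^sub>M m) = \<alpha>\<^sub>M (inv \<beta>\<^sub>M m)"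
    "inv \<beta>\<^sub>M (inv \<alpha>\<^sub>M m) = inv \<alpha>\<^sub>M (inv \<beta>\<^sub>M m)"
    by (rule inv_commute[symmetric, OF bij_betaM], simp only: alphaM_betaM_commute \<beta>\<^sub>M_inv)+
qed

lemma inv_multiplicative:
  "inv \<alpha> (a \<prec> b) = inv \<alpha> a \<prec> inv \<alpha> b" "inv \<alpha> (a \<succ> b) = inv \<alpha> a \<succ> inv \<alpha> b"
  "inv \<beta> (a \<prec> b) = inv \<beta> a \<prec> inv \<beta> b" "inv \<beta> (a \<succ> b) = inv \<beta> a \<succ> inv \<beta> b"
  "inv \<alpha>\<^sub>M (a \<prec>\<^sub>l m) = inv \<alpha> a \<prec>\<^sub>l inv \<alpha>\<^sub>M m" "inv \<alpha>\<^sub>M (a \<succ>\<^sub>l m) = inv \<alpha> a \<succ>\<^sub>l inv \<alpha>\<^sub>M m"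
  "inv \<beta>\<^sub>M (a \<prec>\<^sub>l m) = inv \<beta> a \<prec>\<^sub>l inv \<beta>\<^sub>M m" "inv \<beta>\<^sub>M (a \<succ>\<^sub>l m) = inv \<beta> a \<succ>\<^sub>l inv \<beta>\<^sub>M m"
  "inv \<alpha>\<^sub>M (m \<prec>\<^sub>r a) = inv \<alpha>\<^sub>M m \<prec>\<^sub>r inv \<alpha> a" "inv \<alpha>\<^sub>M (m \<succ>\<^sub>r a) = inv \<alpha>\<^sub>M m \<succ>\<^sub>r inv \<alpha> a"
  "inv \<beta>\<^sub>M (m \<prec>\<^sub>r a) = inv \<beta>\<^sub>M m \<prec>\<^sub>r inv \<beta> a" "inv \<beta>\<^sub>M (m \<succ>\<^sub>r a) = inv \<beta>\<^sub>M m \<succ>\<^sub>r inv \<beta> a"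
  by (rule inv_eqI, simp add: inv_cancel alpha_prec alpha_succ beta_prec beta_succ
      alphaM_lprec alphaM_lsucc alphaM_rprec alphaM_rsucc
      betaM_lprec betaM_lsucc betaM_rprec betaM_rsucc)+

lemmas multiplicative = alpha_prec alpha_succ beta_prec beta_succ
  alphaM_lprec alphaM_lsucc alphaM_rprec alphaM_rsucc
  betaM_lprec betaM_lsucc betaM_rprec betaM_rsucc inv_multiplicative

lemmas inv_linear = linear_inv[OF linear_alpha bij_alpha] linear_inv[OF linear_beta bij_beta]
  linear_inv[OF linear_alphaM bij_alphaM] linear_inv[OF linear_betaM bij_betaM]

lemmas diff_distribs =
  linear_map_diff[OF linear_alpha] linear_map_diff[OF linear_beta]
  linear_map_diff[OF linear_alphaM] linear_map_diff[OF linear_betaM]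
  inv_linear[THEN linear_map_diff]
  bilinear_map_diff_left[OF bilinear_prec] bilinear_map_diff_right[OF bilinear_prec]
  bilinear_map_diff_left[OF bilinear_succ] bilinear_map_diff_right[OF bilinear_succ]
  bilinear_map_diff_left[OF bilinear_lprec] bilinear_map_diff_right[OF bilinear_lprec]
  bilinear_map_diff_left[OF bilinear_lsucc] bilinear_map_diff_right[OF bilinear_lsucc]
  bilinear_map_diff_left[OF bilinear_rprec] bilinear_map_diff_right[OF bilinear_rprec]
  bilinear_map_diff_left[OF bilinear_rsucc] bilinear_map_diff_right[OF bilinear_rsucc]

text \<open>Rewrites to a normal form: differences are multiplied out, structure maps are pushed
  onto the individual elements, and the resulting words are sorted and cancelled.\<close>

lemmas expand = multiplicative diff_distribs structure_maps_commute inv_cancel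

lemma bilinear_lcirc: "bilinear_map sA sM sM (\<odot>\<^sub>l)"
  using bilinear_map_twisted_diff[OF bilinear_lsucc bilinear_rprec
      Vector_Spaces.linear_compose[OF inv_linear(2) linear_alpha] Vector_Spaces.linear_compose[OF linear_betaM inv_linear(3)]]
  by (simp add: o_def)

lemma bilinear_rcirc: "bilinear_map sM sA sM (\<odot>\<^sub>r)"
  using bilinear_map_twisted_diff[OF bilinear_rsucc bilinear_lprec
      Vector_Spaces.linear_compose[OF inv_linear(4) linear_alphaM] Vector_Spaces.linear_compose[OF linear_beta inv_linear(1)]]
  by (simp add: o_def)

lemma circ_multiplicative:
  "\<alpha>\<^sub>M (a \<odot>\<^sub>l m) = \<alpha> a \<odot>\<^sub>l \<alpha>\<^sub>M m" "\<beta>\<^sub>M (a \<odot>\<^sub>l m) = \<beta> a \<odot>\<^sub>l \<beta>\<^sub>M m"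
  "\<alpha>\<^sub>M (m \<odot>\<^sub>r a) = \<alpha>\<^sub>M m \<odot>\<^sub>r \<alpha> a" "\<beta>\<^sub>M (m \<odot>\<^sub>r a) = \<beta>\<^sub>M m \<odot>\<^sub>r \<beta> a"
  by (simp_all add: expand)

text \<open>Once (D1), (D2), (D3) are applied, each side is a sum of three parts, one per axiom.
  Each part is an expression plus its copy with \<open>a\<close> and \<open>b\<close> exchanged, so
  both sides agree.\<close>

lemma prelie_left:
  "\<alpha> (\<beta> a) \<odot>\<^sub>l (\<alpha> b \<odot>\<^sub>l m) - (\<beta> a \<odot> \<alpha> b) \<odot>\<^sub>l \<beta>\<^sub>M m =
   \<alpha> (\<beta> b) \<odot>\<^sub>l (\<alpha> a \<odot>\<^sub>l m) - (\<beta> b \<odot> \<alpha> a) \<odot>\<^sub>l \<beta>\<^sub>M m"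
proof -
  let ?n = "inv \<alpha>\<^sub>M (\<beta>\<^sub>M m)"
  \<comment> \<open>The three facts are kept general in \<open>x\<close> and \<open>y\<close>, since
    the two sides of the goal need them for \<open>a, b\<close> and for \<open>b, a\<close>.\<close>
  have D3: "\<alpha> (\<beta> x) \<succ>\<^sub>l (\<alpha> y \<succ>\<^sub>l m) = (\<beta> x \<prec> \<alpha> y) \<succ>\<^sub>l \<beta>\<^sub>M m + (\<beta> x \<succ> \<alpha> y) \<succ>\<^sub>l \<beta>\<^sub>M m" for x y
    by (rule D3_third)
  have D2: "\<alpha> (\<beta> x) \<succ>\<^sub>l (?n \<prec>\<^sub>r \<alpha> (\<alpha> (inv \<beta> y))) = (\<beta> x \<succ>\<^sub>l ?n) \<prec>\<^sub>r \<alpha> (\<alpha> y)" for x y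
    using D2_second[of "\<beta> x" ?n "\<alpha> (\<alpha> (inv \<beta> y))"] by (simp add: expand)
  \<comment> \<open>Nesting the two products twists \<open>m\<close> twice, which gives the first
    factor. The third argument passed to (D1) carries \<open>inv \<beta>\<close> so that its image
    under \<open>\<beta>\<close> is \<open>\<alpha> (\<alpha> y)\<close>.\<close>
  have D1: "(inv \<alpha>\<^sub>M (inv \<alpha>\<^sub>M (\<beta>\<^sub>M (\<beta>\<^sub>M m))) \<prec>\<^sub>r \<alpha> x) \<prec>\<^sub>r \<alpha> (\<alpha> y) =
      inv \<alpha>\<^sub>M (\<beta>\<^sub>M (\<beta>\<^sub>M m)) \<prec>\<^sub>r (\<alpha> x \<prec> \<alpha> (\<alpha> (inv \<beta> y))) +
      inv \<alpha>\<^sub>M (\<beta>\<^sub>M (\<beta>\<^sub>M m)) \<prec>\<^sub>r (\<alpha> x \<succ> \<alpha> (\<alpha> (inv \<beta> y)))" for x y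
    using D1_first[of "inv \<alpha>\<^sub>M (inv \<alpha>\<^sub>M (\<beta>\<^sub>M (\<beta>\<^sub>M m)))" "\<alpha> x" "\<alpha> (\<alpha> (inv \<beta> y))"]
    by (simp add: expand)
  show ?thesis by (simp add: expand D1 D2 D3)
qed

text \<open>The same cancellation with \<open>m\<close> in place of \<open>b\<close> and
  \<open>c\<close> in place of the old module element. Exchanging \<open>a\<close> and
  \<open>m\<close> now changes which argument lies in the module, so each axiom is needed in two
  placements, one for each side.\<close>

lemma prelie_middle:
  "\<alpha> (\<beta> a) \<odot>\<^sub>l (\<alpha>\<^sub>M m \<odot>\<^sub>r c) - (\<beta> a \<odot>\<^sub>l \<alpha>\<^sub>M m) \<odot>\<^sub>r \<beta> c =
   \<alpha>\<^sub>M (\<beta>\<^sub>M m) \<odot>\<^sub>r (\<alpha> a \<odot> c) - (\<beta>\<^sub>M m \<odot>\<^sub>r \<alpha> a) \<odot>\<^sub>r \<beta> c"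
proof -
  \<comment> \<open>\<open>?d\<close> is \<open>c\<close> after one twist;
    \<open>inv \<alpha> ?e\<close> is \<open>c\<close> after two.\<close>
  let ?d = "inv \<alpha> (\<beta> c)" and ?e = "inv \<alpha> (\<beta> (\<beta> c))"
  have D3: "\<alpha> (\<beta> a) \<succ>\<^sub>l (\<alpha>\<^sub>M m \<succ>\<^sub>r c) = (\<beta> a \<prec>\<^sub>l \<alpha>\<^sub>M m) \<succ>\<^sub>r \<beta> c + (\<beta> a \<succ>\<^sub>l \<alpha>\<^sub>M m) \<succ>\<^sub>r \<beta> c"
    "\<alpha>\<^sub>M (\<beta>\<^sub>M m) \<succ>\<^sub>r (\<alpha> a \<succ> c) = (\<beta>\<^sub>M m \<prec>\<^sub>r \<alpha> a) \<succ>\<^sub>r \<beta> c + (\<beta>\<^sub>M m \<succ>\<^sub>r \<alpha> a) \<succ>\<^sub>r \<beta> c"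
    by (rule D3_second, rule D3_first)
  have D2: "\<alpha> (\<beta> a) \<succ>\<^sub>l (?d \<prec>\<^sub>l \<alpha>\<^sub>M (\<alpha>\<^sub>M (inv \<beta>\<^sub>M m))) = (\<beta> a \<succ> ?d) \<prec>\<^sub>l \<alpha>\<^sub>M (\<alpha>\<^sub>M m)"
    "\<alpha>\<^sub>M (\<beta>\<^sub>M m) \<succ>\<^sub>r (?d \<prec> \<alpha> (\<alpha> (inv \<beta> a))) = (\<beta>\<^sub>M m \<succ>\<^sub>r ?d) \<prec>\<^sub>r \<alpha> (\<alpha> a)"
    using D2_third[of "\<beta> a" ?d "\<alpha>\<^sub>M (\<alpha>\<^sub>M (inv \<beta>\<^sub>M m))"]
      D2_first[of "\<beta>\<^sub>M m" ?d "\<alpha> (\<alpha> (inv \<beta> a))"] by (simp_all add: expand)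
  have D1: "(inv \<alpha> ?e \<prec>\<^sub>l \<alpha>\<^sub>M m) \<prec>\<^sub>r \<alpha> (\<alpha> a) =
      ?e \<prec>\<^sub>l (\<alpha>\<^sub>M m \<prec>\<^sub>r \<alpha> (\<alpha> (inv \<beta> a))) + ?e \<prec>\<^sub>l (\<alpha>\<^sub>M m \<succ>\<^sub>r \<alpha> (\<alpha> (inv \<beta> a)))"
    "(inv \<alpha> ?e \<prec> \<alpha> a) \<prec>\<^sub>l \<alpha>\<^sub>M (\<alpha>\<^sub>M m) =
      ?e \<prec>\<^sub>l (\<alpha> a \<prec>\<^sub>l \<alpha>\<^sub>M (\<alpha>\<^sub>M (inv \<beta>\<^sub>M m))) + ?e \<prec>\<^sub>l (\<alpha> a \<succ>\<^sub>l \<alpha>\<^sub>M (\<alpha>\<^sub>M (inv \<beta>\<^sub>M m)))"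
    using D1_second[of "inv \<alpha> ?e" "\<alpha>\<^sub>M m" "\<alpha> (\<alpha> (inv \<beta> a))"]
      D1_third[of "inv \<alpha> ?e" "\<alpha> a" "\<alpha>\<^sub>M (\<alpha>\<^sub>M (inv \<beta>\<^sub>M m))"] by (simp_all add: expand)
  show ?thesis by (simp add: expand D1 D2 D3)
qed

text \<open>The algebra part enters as a premise because it comes from another instance of this
  locale, the one with the algebra as its own bimodule.\<close>

lemma prelie_bimodule:
  assumes "bihom_prelie_algebra sA (\<odot>) \<alpha> \<beta>"
  shows "bihom_prelie_bimodule sA (\<odot>) \<alpha> \<beta> sM (\<odot>\<^sub>l) (\<odot>\<^sub>r) \<alpha>\<^sub>M \<beta>\<^sub>M"
  by (intro bihom_prelie_bimodule.intro bihom_prelie_bimodule_axioms.intro assms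
      M.vector_space_axioms bilinear_lcirc bilinear_rcirc linear_alphaM linear_betaM
      alphaM_betaM_commute circ_multiplicative prelie_left prelie_middle)

end

theorem proposition2p40:
  fixes sA :: "'k::field \<Rightarrow> 'a::ab_group_add \<Rightarrow> 'a"
    and precA succA :: "'a \<Rightarrow> 'a \<Rightarrow> 'a"
    and \<alpha>\<^sub>A \<beta>\<^sub>A :: "'a \<Rightarrow> 'a"
    and sM :: "'k \<Rightarrow> 'm::ab_group_add \<Rightarrow> 'm"
    and lprec lsucc :: "'a \<Rightarrow> 'm \<Rightarrow> 'm"
    and rprec rsucc :: "'m \<Rightarrow> 'a \<Rightarrow> 'm"
    and \<alpha>\<^sub>M \<beta>\<^sub>M :: "'m \<Rightarrow> 'm"
  assumes "bihom_dendriform_algebra sA precA succA \<alpha>\<^sub>A \<beta>\<^sub>A"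
    and "bij \<alpha>\<^sub>A" and "bij \<beta>\<^sub>A"
    and "bihom_dendriform_bimodule sA precA succA \<alpha>\<^sub>A \<beta>\<^sub>A sM lprec lsucc rprec rsucc \<alpha>\<^sub>M \<beta>\<^sub>M"
    and "bij \<alpha>\<^sub>M" and "bij \<beta>\<^sub>M"
  shows
    "let circ = (\<lambda>a b. succA a b - precA (inv \<alpha>\<^sub>A (\<beta>\<^sub>A b)) (\<alpha>\<^sub>A (inv \<beta>\<^sub>A a)));
         lcirc = (\<lambda>a m. lsucc a m - rprec (inv \<alpha>\<^sub>M (\<beta>\<^sub>M m)) (\<alpha>\<^sub>A (inv \<beta>\<^sub>A a)));
         rcirc = (\<lambda>m a. rsucc m a - lprec (inv \<alpha>\<^sub>A (\<beta>\<^sub>A a)) (\<alpha>\<^sub>M (inv \<beta>\<^sub>M m)))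
     in bihom_prelie_algebra sA circ \<alpha>\<^sub>A \<beta>\<^sub>A \<and>
        bihom_prelie_bimodule sA circ \<alpha>\<^sub>A \<beta>\<^sub>A sM lcirc rcirc \<alpha>\<^sub>M \<beta>\<^sub>M"
proof -
  interpret A: bihom_dendriform_algebra sA precA succA \<alpha>\<^sub>A \<beta>\<^sub>A by fact
  interpret R: invertible_bihom_dendriform_bimodule sA precA succA \<alpha>\<^sub>A \<beta>\<^sub>A sA
    precA succA precA succA \<alpha>\<^sub>A \<beta>\<^sub>A
    using assms by (intro invertible_bihom_dendriform_bimodule.intro A.regular_bimodule
        invertible_bihom_dendriform_bimodule_axioms.intro)
  interpret M: invertible_bihom_dendriform_bimodule sA precA succA \<alpha>\<^sub>A \<beta>\<^sub>A sM
    lprec lsucc rprec rsucc \<alpha>\<^sub>M \<beta>\<^sub>M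
    using assms by (intro invertible_bihom_dendriform_bimodule.intro
        invertible_bihom_dendriform_bimodule_axioms.intro)
  \<comment> \<open>For the regular bimodule all three products coincide, so the facts about
    \<open>R.lcirc\<close> are exactly the pre-Lie axioms for \<open>R.circ\<close>.\<close>
  have "bihom_prelie_algebra sA R.circ \<alpha>\<^sub>A \<beta>\<^sub>A"
    by (intro bihom_prelie_algebra.intro bihom_prelie_algebra_axioms.intro
        A.vector_space_axioms R.bilinear_lcirc A.linear_alpha A.linear_beta
        A.alpha_beta_commute R.circ_multiplicative R.prelie_left)
  then show ?thesis
    \<comment> \<open>\<open>R.circ\<close> and \<open>M.circ\<close> involve only the algebra
      operations and unfold to the same function, so the premise of \<open>M.prelie_bimodule\<close>
      is met.\<close>
    using M.prelie_bimodule by (simp add: Let_def)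
qed

end
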